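(* Let $F$ be a field and let $m,n_1,\dots,n_k$ be positive integers such that the characteristic of $F$ is zero or coprime to every $n_i$. For $i=1,\dots,k$ let $g_i(X)=\sum_{j=0}^{n_i-1}g_{ij}X^j\in F[X]$, and let $M(g_1,\dots,g_k)_{m\times(n_1+\cdots+n_k)}$ be the multiple circulant matrix associated with $g_1(X),\dots,g_k(X)$. Let $$s=\deg\operatorname{lcm}\left(\frac{X^{n_1}-1}{\gcd\big(g_1(X),X^{n_1}-1\big)},\;\dots,\;\frac{X^{n_k}-1}{\gcd\big(g_k(X),X^{n_k}-1\big)}\right)$$ and let $r=\min\{m,s\}$. Then $$\operatorname{rank} M(g_1,\dots,g_k)_{m\times(n_1+\cdots+n_k)}=r,$$ and the first $r$ consecutive rows of $M(g_1,\dots,g_k)_{m\times(n_1+\cdots+n_k)}$ are linearly independent.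
   Context: For a polynomial $g(X)=\sum_{j=0}^{n-1}g_jX^j$ over $F$ of degree less than $n$, the generalized circulant matrix $M(g)_{m\times n}$ is the $m\times n$ matrix over $F$ whose $i$-th row ($i=0,1,\dots,m-1$, rows counted from $0$) is $\mathcal S^i(g_0,g_1,\dots,g_{n-1})$, where $\mathcal S(a_0,a_1,\dots,a_{n-1})=(a_{n-1},a_0,\dots,a_{n-2})$ is the circular shift on $F^n$. Equivalently, its $(i,j)$ entry ($0\le i<m$, $0\le j<n$) is $g_{(j-i)\bmod n}$. The multiple circulant matrix associated with $g_1(X),\dots,g_k(X)$ (with $\deg g_i<n_i$) is the side-by-side concatenation $M(g_1,\dots,g_k)_{m\times(n_1+\cdots+n_k)}=\big(M(g_1)_{m\times n_1}\,\big|\,\cdots\,\big|\,M(g_k)_{m\times n_k}\big)$. Here $\gcd$ and $\operatorname{lcm}$ of polynomials are taken in $F[X]$ (with $\gcd(0,f)=f$). *)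

theory Defs
  imports
    "HOL-Computational_Algebra.Polynomial_Factorial"
    "Jordan_Normal_Form.DL_Rank"
begin

text \<open>
  The field is a type of class \<^class>\<open>field_gcd\<close>, the library's class of fields over which
  \<^const>\<open>gcd\<close> and \<^const>\<open>Lcm\<close> of polynomials are available. This does not restrict the field:
  the additional operations (unit factor, normalization, Euclidean size, trivial gcd of scalars)
  exist on every field. The gcd and lcm of polynomials are the monic ones (or 0); in particular
  the gcd of 0 and a monic \<open>f\<close> is \<open>f\<close>.
\<close>

definition circ_shift :: "'a vec \<Rightarrow> 'a vec" where
  "circ_shift a = vec (dim_vec a) (\<lambda>j. if j = 0 then a $ (dim_vec a - 1) else a $ (j - 1))"

definition gen_circulant :: "nat \<Rightarrow> nat \<Rightarrow> 'a::zero poly \<Rightarrow> 'a mat" where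
  "gen_circulant m n g =
     mat_of_rows n (map (\<lambda>i. (circ_shift ^^ i) (vec n (coeff g))) [0..<m])"

text \<open>The blocks are indexed from 1 to \<open>k\<close>. They are placed side by side by concatenating their
  lists of columns.\<close>

definition multi_circulant ::
  "nat \<Rightarrow> nat \<Rightarrow> (nat \<Rightarrow> nat) \<Rightarrow> (nat \<Rightarrow> 'a::zero poly) \<Rightarrow> 'a mat" where
  "multi_circulant m k n g =
     mat_of_cols m (concat (map (\<lambda>i. cols (gen_circulant m (n i) (g i))) [1..<Suc k]))"

lemma dim_circ_shift [simp]: "dim_vec (circ_shift a) = dim_vec a"
  by (simp add: circ_shift_def)

lemma circ_shift_index:
  "j < dim_vec a \<Longrightarrow> circ_shift a $ j = (if j = 0 then a $ (dim_vec a - 1) else a $ (j - 1))"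
  by (simp add: circ_shift_def)

lemma dim_circ_shift_funpow [simp]: "dim_vec ((circ_shift ^^ i) a) = dim_vec a"
  by (induction i) simp_all

lemma circ_shift_funpow_index:
  assumes "j < dim_vec a"
  shows "(circ_shift ^^ i) a $ j = a $ nat ((int j - int i) mod int (dim_vec a))"
  using assms
proof (induction i arbitrary: j)
  case 0
  then show ?case by simp
next
  case (Suc i)
  let ?n = "dim_vec a"
  define j' where "j' = (if j = 0 then ?n - 1 else j - 1)"
  have j': "j' < ?n" using Suc.prems unfolding j'_def by (split if_split) linarith
  have "int j' - int i = (int j - int (Suc i)) + (if j = 0 then int ?n else 0)"
    using Suc.prems by (simp add: j'_def of_nat_diff)
  then have mod: "(int j' - int i) mod int ?n = (int j - int (Suc i)) mod int ?n"
    by (cases "j = 0") (simp_all only: simp_thms if_True if_False mod_add_self2 add_0_right)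
  have "(circ_shift ^^ Suc i) a $ j = (circ_shift ^^ i) a $ j'"
    using Suc.prems by (simp add: circ_shift_index j'_def)
  then show ?case
    by (simp only: Suc.IH[OF j'] mod)
qed

lemma gen_circulant_carrier [simp]: "gen_circulant m n g \<in> carrier_mat m n"
  unfolding gen_circulant_def carrier_mat_def by simp

lemma gen_circulant_index:
  assumes "i < m" "j < n"
  shows "gen_circulant m n g $$ (i, j) = coeff g (nat ((int j - int i) mod int n))"
proof -
  have lt: "nat ((int j - int i) mod int n) < n"
    using assms(2) by (simp add: nat_less_iff)
  have "gen_circulant m n g $$ (i, j) = (circ_shift ^^ i) (vec n (coeff g)) $ j"
    using assms by (simp add: gen_circulant_def mat_of_rows_def)
  also have "\<dots> = vec n (coeff g) $ nat ((int j - int i) mod int n)"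
    using circ_shift_funpow_index[of j "vec n (coeff g)" i] assms(2) by simp
  finally show ?thesis using lt by simp
qed

lemma multi_circulant_carrier: "multi_circulant m k n g \<in> carrier_mat m (\<Sum>i = 1..k. n i)"
proof -
  have "(\<Sum>i\<leftarrow>[1..<Suc k]. length (cols (gen_circulant m (n i) (g i)))) = (\<Sum>i\<leftarrow>[1..<Suc k]. n i)"
    unfolding cols_length carrier_matD(2)[OF gen_circulant_carrier] ..
  also have "\<dots> = (\<Sum>i = 1..k. n i)"
    unfolding interv_sum_list_conv_sum_set_nat set_upt atLeastLessThanSuc_atLeastAtMost ..
  finally show ?thesis
    unfolding multi_circulant_def carrier_mat_def by (simp add: length_concat o_def del: upt_Suc)
qed

end

theory Submission
  imports Defs
begin

text \<open>
  Row \<open>i\<close> of the block of \<open>g\<^sub>l\<close> lists the coefficients of \<open>X ^ i * g\<^sub>l\<close> modulo \<open>X ^ n\<^sub>l - 1\<close>, because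
  a circular shift is multiplication by \<open>X\<close> modulo \<open>X ^ n\<^sub>l - 1\<close>. A combination of the rows with
  coefficients \<open>v\<^sub>0, ..., v\<^sub>m\<^sub>-\<^sub>1\<close>, read as a polynomial \<open>V\<close> of degree less than \<open>m\<close>, therefore
  vanishes on that block exactly when \<open>X ^ n\<^sub>l - 1\<close> divides \<open>V * g\<^sub>l\<close>, that is, when
  \<open>(X ^ n\<^sub>l - 1) / gcd (g\<^sub>l, X ^ n\<^sub>l - 1)\<close> divides \<open>V\<close>. Over all blocks, the relations between the rows
  are the multiples \<open>V\<close> of the least common multiple \<open>h\<close> of these quotients
  (\<open>multi_circulant_left_kernel\<close>).

  The rest is linear algebra. A nonzero multiple of \<open>h\<close> has degree at least \<open>s = degree h\<close>, so the
  first \<open>r = min m s\<close> rows satisfy no nontrivial relation. Conversely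
  \<open>X ^ i - (X ^ i mod h)\<close> is a multiple of \<open>h\<close>, which expresses row \<open>i\<close> by the first \<open>r\<close> rows and
  bounds the rank by \<open>r\<close>. Since the rank is defined as the dimension of the column space, both
  conclusions are transferred from rows to columns: the coefficients of these expressions form an
  \<open>m \<times> r\<close> matrix whose range contains all columns (\<open>rank_le_if_cols_in_range\<close>), and a column space
  of dimension less than \<open>r\<close> would leave room for a relation between the first \<open>r\<close> rows
  (\<open>rank_ge_if_rows_independent\<close>).
\<close>

section \<open>Rank from the linear relations between the rows\<close>

text \<open>
  Orthogonality to fewer than \<open>r\<close> vectors is a homogeneous system with fewer equations than unknowns
  in the first \<open>r\<close> coordinates. Filled up with zero rows, its matrix is square and singular.
\<close>

lemma nonzero_vec_orthogonal_to_fewer: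
  fixes S :: "'a::field vec set"
  assumes S: "finite S" "card S < r" and r: "r \<le> n"
  obtains v where "v \<in> carrier_vec n" "v \<noteq> 0\<^sub>v n" "\<And>i. r \<le> i \<Longrightarrow> i < n \<Longrightarrow> v $ i = 0"
    "\<And>x. x \<in> S \<Longrightarrow> x \<in> carrier_vec n \<Longrightarrow> v \<bullet> x = 0"
proof -
  obtain xs where xs: "set xs = S" "length xs = card S"
    using S(1) by (metis distinct_card finite_distinct_list)
  define row_vec where "row_vec j = vec r (\<lambda>i. if j < length xs then xs ! j $ i else 0)" for j
  define A where "A = mat\<^sub>r r r (\<lambda>j. if j = r - 1 then 0\<^sub>v r else row_vec j)"
  have A: "A \<in> carrier_mat r r" by (simp add: A_def)
  have "det A = 0"
    unfolding A_def by (rule det_row_0) (use S in \<open>auto simp: row_vec_def\<close>)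
  then obtain u where u: "u \<in> carrier_vec r" "u \<noteq> 0\<^sub>v r" "A *\<^sub>v u = 0\<^sub>v r"
    using det_0_iff_vec_prod_zero_field[OF A] by blast
  define v where "v = vec n (\<lambda>i. if i < r then u $ i else 0)"
  have "v \<noteq> 0\<^sub>v n"
  proof
    assume v0: "v = 0\<^sub>v n"
    have "u $ i = 0" if "i < r" for i
      using arg_cong[OF v0, of "\<lambda>w. w $ i"] that r by (simp add: v_def)
    then have "u = 0\<^sub>v r" using u(1) by (intro eq_vecI) auto
    with u(2) show False ..
  qed
  moreover have "v \<bullet> x = 0" if x: "x \<in> S" "x \<in> carrier_vec n" for x
  proof -
    obtain j where j: "j < length xs" "x = xs ! j"
      using x(1) xs(1) by (metis in_set_conv_nth)
    have jr: "j < r" "j \<noteq> r - 1" using j(1) xs(2) S(2) by auto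
    have "v \<bullet> x = (\<Sum>i<n. if i < r then u $ i * x $ i else 0)"
      using x(2) by (auto simp: scalar_prod_def v_def lessThan_atLeast0 intro!: sum.cong)
    also have "\<dots> = (\<Sum>i<r. u $ i * x $ i)"
      using r by (intro sum.mono_neutral_cong_right) auto
    also have "\<dots> = (A *\<^sub>v u) $ j"
      using j jr u(1)
      by (auto simp: A_def row_vec_def scalar_prod_def lessThan_atLeast0 mult.commute
          intro!: sum.cong)
    finally show ?thesis using u(3) jr(1) by simp
  qed
  ultimately show thesis by (intro that[of v]) (auto simp: v_def)
qed

context vec_space
begin

lemma column_basis:
  assumes A: "A \<in> carrier_mat n nc"
  obtains S where "S \<subseteq> set (cols A)" "lin_indpt S" "card S = rank A" "set (cols A) \<subseteq> span S"
proof -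
  have carr: "set (cols A) \<subseteq> carrier_vec n" using cols_dim A by blast
  have li0: "lin_indpt {}"
    by (metis empty_subsetI fin_dim finite_basis_exists subset_li_is_li vec_vs
        vectorspace.basis_def)
  obtain S where S: "maximal S (\<lambda>T. T \<subseteq> set (cols A) \<and> lin_indpt T)"
    using maximal_exists_superset[of "set (cols A)" "\<lambda>T. T \<subseteq> set (cols A) \<and> lin_indpt T" "{}"] li0
    by auto
  then have sub: "S \<subseteq> set (cols A)" and li: "lin_indpt S" by (auto simp: maximal_def)
  have "x \<in> span S" if x: "x \<in> set (cols A)" for x
  proof (rule ccontr)
    assume nx: "x \<notin> span S"
    then have "x \<notin> S" using sub carr span_mem by auto
    then have "lin_indpt (S \<union> {x})"
      using lin_dep_iff_in_span[of S x] nx sub carr x li by auto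
    then show False using S x sub \<open>x \<notin> S\<close> unfolding maximal_def by blast
  qed
  then show thesis
    using that[of S] sub li rank_card_indpt[OF A S] by auto
qed

lemma rank_le_if_cols_in_range:
  assumes A: "A \<in> carrier_mat n nc" and B: "B \<in> carrier_mat n r"
    and cols: "\<And>x. x \<in> set (cols A) \<Longrightarrow> \<exists>y\<in>carrier_vec r. x = B *\<^sub>v y"
  shows "rank A \<le> r"
proof -
  obtain S where S: "S \<subseteq> set (cols A)" "lin_indpt S" "card S = rank A"
    using column_basis[OF A] .
  have "x \<in> span (set (cols B))" if "x \<in> S" for x
    using col_space_eq[OF B] cols[of x] S(1) that B cols_dim[of A] A unfolding col_space_def by auto
  then have "S \<subseteq> span (set (cols B))" by blast
  moreover have "finite S" using S(1) finite_subset by blast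
  moreover have "set (cols B) \<subseteq> carrier_vec n" using cols_dim B by blast
  ultimately have "int (card S) \<le> int (card (set (cols B)))"
    using replacement[of S "set (cols B)"] S(2) by force
  also have "card (set (cols B)) \<le> r"
    using card_length[of "cols B"] B by simp
  finally show ?thesis using S(3) by simp
qed

text \<open>
  Row rank is at most column rank. Here and below a linear relation between the rows is a vector
  orthogonal to all columns, and independence of the first \<open>r\<close> rows means that no nonzero relation
  is supported on the first \<open>r\<close> coordinates. Fewer than \<open>r\<close> columns spanning the column space would
  admit a nonzero vector of this support orthogonal to all of them.
\<close>

lemma rank_ge_if_rows_independent:
  assumes A: "A \<in> carrier_mat n nc" and r: "r \<le> n"
    and indep: "\<And>v. v \<in> carrier_vec n \<Longrightarrow> (\<And>i. r \<le> i \<Longrightarrow> i < n \<Longrightarrow> v $ i = 0) \<Longrightarrow>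
      (\<And>x. x \<in> set (cols A) \<Longrightarrow> v \<bullet> x = 0) \<Longrightarrow> v = 0\<^sub>v n"
  shows "r \<le> rank A"
proof (rule ccontr)
  assume "\<not> r \<le> rank A"
  obtain S where S: "S \<subseteq> set (cols A)" "card S = rank A" "set (cols A) \<subseteq> span S"
    using column_basis[OF A] by metis
  have carr: "S \<subseteq> carrier_vec n" using S(1) cols_dim A by blast
  have "finite S" "card S < r"
    using S \<open>\<not> r \<le> rank A\<close> finite_subset by auto
  then obtain v where v: "v \<in> carrier_vec n" "v \<noteq> 0\<^sub>v n"
    "\<And>i. r \<le> i \<Longrightarrow> i < n \<Longrightarrow> v $ i = 0"
    "\<And>x. x \<in> S \<Longrightarrow> x \<in> carrier_vec n \<Longrightarrow> v \<bullet> x = 0"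
    using nonzero_vec_orthogonal_to_fewer[OF _ _ r] by blast
  then have "v \<in> orthogonal_complement S"
    using carr by (auto simp: orthogonal_complement_def)
  then have "v \<in> orthogonal_complement (span S)"
    using in_orthogonal_complement_span[OF carr] by simp
  then have "v \<bullet> x = 0" if "x \<in> set (cols A)" for x
    using S(3) that by (auto simp: orthogonal_complement_def)
  with indep[OF v(1,3)] v(2) show False by blast
qed

end

text \<open>
  Equality of the rows with indices \<open>a \<noteq> b\<close> gives the relation \<open>e\<^sub>a - e\<^sub>b\<close>. Distinctness is needed before linear
  independence, so that a combination over the set of rows is one over their indices.
\<close>

lemma first_rows_lin_indpt:
  fixes A :: "'a::field mat"
  assumes A: "A \<in> carrier_mat n nc" and r: "r \<le> n"
    and indep: "\<And>v. v \<in> carrier_vec n \<Longrightarrow> (\<And>i. r \<le> i \<Longrightarrow> i < n \<Longrightarrow> v $ i = 0) \<Longrightarrow>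
      (\<And>x. x \<in> set (cols A) \<Longrightarrow> v \<bullet> x = 0) \<Longrightarrow> v = 0\<^sub>v n"
  shows "distinct (take r (rows A))"
    and "module.lin_indpt class_ring (module_vec TYPE('a) nc) (set (take r (rows A)))"
proof -
  interpret V: vec_space "TYPE('a)" nc .
  have nth: "take r (rows A) ! i = row A i" if "i < r" for i
    using that r A by simp
  have indep': "\<forall>i<r. u i = 0"
    if rel: "\<And>j. j < nc \<Longrightarrow> (\<Sum>i<r. u i * A $$ (i, j)) = 0" for u :: "nat \<Rightarrow> 'a"
  proof -
    define v where "v = vec n (\<lambda>i. if i < r then u i else 0)"
    have "v \<bullet> x = 0" if x: "x \<in> set (cols A)" for x
    proof -
      obtain j where j: "j < nc" "x = col A j"
        using x A by (auto simp: in_set_conv_nth)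
      have "v \<bullet> x = (\<Sum>i<n. if i < r then u i * A $$ (i, j) else 0)"
        using A j by (auto simp: scalar_prod_def v_def lessThan_atLeast0 intro!: sum.cong)
      also have "\<dots> = (\<Sum>i<r. u i * A $$ (i, j))"
        using r by (intro sum.mono_neutral_cong_right) auto
      finally show ?thesis using rel[OF j(1)] by simp
    qed
    then have v0: "v = 0\<^sub>v n" by (intro indep) (auto simp: v_def)
    have "u i = 0" if "i < r" for i
      using arg_cong[OF v0, of "\<lambda>w. w $ i"] that r by (simp add: v_def)
    then show ?thesis by blast
  qed
  show dist: "distinct (take r (rows A))"
  proof (rule ccontr)
    assume "\<not> distinct (take r (rows A))"
    then obtain a b where ab: "a < r" "b < r" "a \<noteq> b" "row A a = row A b"
      using nth r A by (auto simp: distinct_conv_nth)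
    define u :: "nat \<Rightarrow> 'a" where "u i = (if i = a then 1 else 0) - (if i = b then 1 else 0)" for i
    have "(\<Sum>i<r. u i * A $$ (i, j)) = 0" if "j < nc" for j
    proof -
      have "(\<Sum>i<r. u i * A $$ (i, j)) =
        (\<Sum>i<r. (if i = a then A $$ (i, j) else 0) - (if i = b then A $$ (i, j) else 0))"
        by (intro sum.cong) (auto simp: u_def)
      also have "\<dots> = A $$ (a, j) - A $$ (b, j)"
        using ab by (simp add: sum_subtractf)
      also have "A $$ (a, j) = A $$ (b, j)"
        using ab r A that by (metis carrier_matD index_row(1) order_less_le_trans)
      finally show ?thesis by simp
    qed
    with indep' have "u a = 0" using ab(1) by blast
    with ab(3) show False by (simp add: u_def)
  qed
  show "V.lin_indpt (set (take r (rows A)))"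
  proof
    assume dep: "V.lin_dep (set (take r (rows A)))"
    define T where "T = mat_of_cols nc (take r (rows A))"
    have T: "T \<in> carrier_mat nc r" using A r by (auto simp: T_def)
    have colsT: "cols T = take r (rows A)"
      unfolding T_def
    proof (rule cols_mat_of_cols)
      show "set (take r (rows A)) \<subseteq> carrier_vec nc"
        using rows_carrier[of A] carrier_matD(2)[OF A] set_take_subset[of r "rows A"] by simp
    qed
    obtain u where u: "u \<in> carrier_vec r" "u \<noteq> 0\<^sub>v r" "T *\<^sub>v u = 0\<^sub>v nc"
      using V.lin_depE[OF T, unfolded colsT, OF dep dist] by blast
    have rel: "(\<Sum>i<r. u $ i * A $$ (i, j)) = 0" if j: "j < nc" for j
    proof -
      have entry: "T $$ (j, i) = A $$ (i, j)" if "i < r" for i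
        using that j A r by (simp add: T_def mat_of_cols_index)
      have "(T *\<^sub>v u) $ j = (\<Sum>i<r. T $$ (j, i) * u $ i)"
        using j u(1) T by (simp add: scalar_prod_def lessThan_atLeast0)
      also have "\<dots> = (\<Sum>i<r. u $ i * A $$ (i, j))"
        by (intro sum.cong) (simp_all add: entry mult.commute)
      finally have "(\<Sum>i<r. u $ i * A $$ (i, j)) = (T *\<^sub>v u) $ j" by simp
      then show ?thesis using u(3) j by simp
    qed
    have "u $ i = 0" if "i < r" for i
      using indep'[of "\<lambda>i. u $ i", OF rel] that by blast
    with u(1) have "u = 0\<^sub>v r" by (intro eq_vecI) auto
    with u(2) show False ..
  qed
qed

section \<open>Circulant blocks and polynomials modulo \<open>X ^ n - 1\<close>\<close>

definition poly_of_vec :: "'a::comm_monoid_add vec \<Rightarrow> 'a poly" where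
  "poly_of_vec v = (\<Sum>i<dim_vec v. monom (v $ i) i)"

lemma coeff_poly_of_vec: "coeff (poly_of_vec v) i = (if i < dim_vec v then v $ i else 0)"
  by (simp add: poly_of_vec_def coeff_sum)

lemma poly_of_vec_coeff:
  assumes "\<And>i. n \<le> i \<Longrightarrow> coeff p i = 0"
  shows "poly_of_vec (vec n (coeff p)) = p"
  using assms by (intro poly_eqI) (auto simp: coeff_poly_of_vec)

lemma degree_poly_of_vec_less:
  assumes "0 < n" "\<And>i. n \<le> i \<Longrightarrow> i < dim_vec v \<Longrightarrow> v $ i = 0"
  shows "degree (poly_of_vec v) < n"
proof -
  have "degree (poly_of_vec v) \<le> n - 1"
    using assms by (intro degree_le) (auto simp: coeff_poly_of_vec)
  with assms(1) show ?thesis by simp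
qed

text \<open>
  The last entry, which the shift moves to the front, is the coefficient of \<open>X ^ n\<close> in the product
  with \<open>X\<close>; subtracting its multiple of \<open>X ^ n - 1\<close> turns it into the constant coefficient.
\<close>

lemma poly_of_vec_circ_shift:
  fixes a :: "'a::comm_ring_1 vec"
  assumes "dim_vec a = n" "0 < n"
  shows "pCons 0 (poly_of_vec a) =
    poly_of_vec (circ_shift a) + Polynomial.smult (a $ (n - 1)) (monom 1 n - 1)"
proof (rule poly_eqI)
  fix i
  show "coeff (pCons 0 (poly_of_vec a)) i =
    coeff (poly_of_vec (circ_shift a) + Polynomial.smult (a $ (n - 1)) (monom 1 n - 1)) i"
  proof (cases i)
    case (Suc l)
    have "l = n - 1" if "l < n" "\<not> Suc l < n" using that by simp
    with Suc assms show ?thesis by (auto simp: coeff_poly_of_vec circ_shift_index)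
  qed (use assms in \<open>auto simp: coeff_poly_of_vec circ_shift_index\<close>)
qed

lemma poly_of_vec_circ_shift_funpow:
  fixes a :: "'a::comm_ring_1 vec"
  assumes n: "dim_vec a = n" "0 < n"
  shows "(monom 1 n - 1) dvd monom 1 i * poly_of_vec a - poly_of_vec ((circ_shift ^^ i) a)"
proof (induction i)
  case (Suc i)
  let ?b = "(circ_shift ^^ i) a"
  have "monom 1 (Suc i) * poly_of_vec a - poly_of_vec (circ_shift ?b) =
    pCons 0 (monom 1 i * poly_of_vec a - poly_of_vec ?b)
    + (pCons 0 (poly_of_vec ?b) - poly_of_vec (circ_shift ?b))"
    by (simp add: monom_Suc)
  also have "\<dots> = [:0, 1:] * (monom 1 i * poly_of_vec a - poly_of_vec ?b)
    + [:?b $ (n - 1):] * (monom 1 n - 1)"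
    using poly_of_vec_circ_shift[of ?b n] n by simp
  also have "(monom 1 n - 1) dvd \<dots>"
    using Suc by (intro dvd_add dvd_mult) auto
  finally show ?case by simp
qed simp

lemma monom_minus_one:
  assumes "0 < n"
  shows "degree (monom 1 n - 1 :: 'a::comm_ring_1 poly) = n" "monom 1 n - 1 \<noteq> (0 :: 'a poly)"
proof -
  show "degree (monom 1 n - 1 :: 'a poly) = n"
    using assms by (intro antisym degree_le le_degree) (auto simp: coeff_1)
  then show "monom 1 n - 1 \<noteq> (0 :: 'a poly)" using assms by force
qed

text \<open>
  The combination \<open>w\<close> of the rows, as a polynomial, is congruent to \<open>poly_of_vec v * g\<close> modulo
  \<open>X ^ n - 1\<close>. Its degree is less than \<open>n\<close>, so it is zero as soon as it is divisible by
  \<open>X ^ n - 1\<close>.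
\<close>

lemma gen_circulant_left_kernel:
  fixes g :: "'a::field poly"
  assumes n: "0 < n" and g: "degree g < n" and v: "v \<in> carrier_vec m"
  shows "(\<forall>x\<in>set (cols (gen_circulant m n g)). v \<bullet> x = 0) \<longleftrightarrow>
    (monom 1 n - 1) dvd poly_of_vec v * g"
proof -
  let ?f = "monom 1 n - 1 :: 'a poly" and ?G = "gen_circulant m n g"
  let ?row = "\<lambda>i. (circ_shift ^^ i) (vec n (coeff g))"
  define w where "w = (\<Sum>i<m. Polynomial.smult (v $ i) (poly_of_vec (?row i)))"
  have row: "?G $$ (i, j) = ?row i $ j" if "i < m" "j < n" for i j
    using that by (simp add: gen_circulant_def mat_of_rows_def)
  have w_coeff: "coeff w j = v \<bullet> col ?G j" if "j < n" for j
    using that v carrier_matD[OF gen_circulant_carrier[of m n g]]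
    by (auto simp: w_def coeff_sum coeff_poly_of_vec scalar_prod_def lessThan_atLeast0 row
        intro!: sum.cong)
  have w_high: "coeff w j = 0" if "n \<le> j" for j
    using that by (simp add: w_def coeff_sum coeff_poly_of_vec)
  have "(\<forall>x\<in>set (cols ?G). v \<bullet> x = 0) \<longleftrightarrow> (\<forall>j<n. coeff w j = 0)"
    using carrier_matD[OF gen_circulant_carrier[of m n g]] by (auto simp: cols_def w_coeff)
  also have "\<dots> \<longleftrightarrow> w = 0"
    using w_high by (metis coeff_0 leading_coeff_0_iff not_le)
  also have "\<dots> \<longleftrightarrow> ?f dvd w"
  proof
    assume "?f dvd w"
    moreover have "degree w < degree ?f" if "w \<noteq> 0"
      using that w_high monom_minus_one(1)[OF n, where 'a = 'a]
      by (metis leading_coeff_0_iff not_le)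
    ultimately show "w = 0" using dvd_imp_degree_le not_less by blast
  qed simp
  also have "\<dots> \<longleftrightarrow> ?f dvd poly_of_vec v * g"
  proof -
    have "poly_of_vec v * g - w =
      (\<Sum>i<m. [:v $ i:] * (monom 1 i * g - poly_of_vec (?row i)))"
    proof -
      have "monom (v $ i) i * g - Polynomial.smult (v $ i) p = [:v $ i:] * (monom 1 i * g - p)"
        for i p
        by (simp add: smult_diff_right smult_monom flip: mult_smult_left)
      then show ?thesis
        using v by (simp add: w_def poly_of_vec_def sum_distrib_right flip: sum_subtractf)
    qed
    also have "?f dvd \<dots>"
    proof (intro dvd_sum dvd_mult)
      fix i
      have "poly_of_vec (vec n (coeff g)) = g"
        using g by (intro poly_of_vec_coeff) (auto intro: coeff_eq_0)
      then show "?f dvd monom 1 i * g - poly_of_vec (?row i)"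
        using poly_of_vec_circ_shift_funpow[of "vec n (coeff g)" n i] n by simp
    qed
    finally have "?f dvd poly_of_vec v * g - w" .
    then show ?thesis using dvd_diff_right_iff by (metis dvd_diff_left_iff)
  qed
  finally show ?thesis .
qed

text \<open>
  Cancelling \<open>gcd g f\<close> on both sides leaves a cofactor of \<open>f\<close> that is coprime to the one of \<open>g\<close>.
\<close>

lemma dvd_mult_iff_div_gcd_dvd:
  fixes f g p :: "'a::semiring_gcd"
  assumes "f \<noteq> 0"
  shows "f dvd p * g \<longleftrightarrow> f div gcd g f dvd p"
proof -
  define d where "d = gcd g f"
  have d: "d \<noteq> 0" using assms by (simp add: d_def)
  have f: "f = d * (f div d)" and g: "g = d * (g div d)" by (simp_all add: d_def)
  have "coprime (g div d) (f div d)"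
    unfolding d_def using assms by (intro div_gcd_coprime) auto
  then have cop: "coprime (f div d) (g div d)" by (simp add: coprime_commute)
  have "p * g = d * (p * (g div d))"
    by (subst g) (rule mult.left_commute)
  then have "f dvd p * g \<longleftrightarrow> d * (f div d) dvd d * (p * (g div d))"
    using f by simp
  also have "\<dots> \<longleftrightarrow> f div d dvd p"
    using d cop by (simp add: coprime_dvd_mult_left_iff)
  finally show ?thesis by (simp add: d_def)
qed

section \<open>Multiple circulant matrices\<close>

lemma set_cols_multi_circulant:
  "set (cols (multi_circulant m k n g)) =
    (\<Union>i\<in>{1..k}. set (cols (gen_circulant m (n i) (g i))))"
proof -
  let ?cs = "concat (map (\<lambda>i. cols (gen_circulant m (n i) (g i))) [1..<Suc k])"
  have set: "set ?cs = (\<Union>i\<in>{1..k}. set (cols (gen_circulant m (n i) (g i))))"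
    by (simp add: atLeastLessThanSuc_atLeastAtMost del: upt_Suc)
  have "set (cols (gen_circulant m (n i) (g i))) \<subseteq> carrier_vec m" for i
    using cols_dim[of "gen_circulant m (n i) (g i)"] carrier_matD(1)[OF gen_circulant_carrier] by metis
  then have "cols (multi_circulant m k n g) = ?cs"
    unfolding multi_circulant_def by (intro cols_mat_of_cols) (auto simp: set)
  with set show ?thesis by simp
qed

text \<open>
  This describes all linear relations between the rows of a multiple circulant matrix: they are the
  coefficient vectors of the multiples of one polynomial.
\<close>

lemma multi_circulant_left_kernel:
  fixes g :: "nat \<Rightarrow> 'a::field_gcd poly"
  assumes "\<forall>i\<in>{1..k}. 0 < n i" "\<forall>i\<in>{1..k}. degree (g i) < n i" "v \<in> carrier_vec m"
  shows "(\<forall>x\<in>set (cols (multi_circulant m k n g)). v \<bullet> x = 0) \<longleftrightarrow>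
    (LCM i\<in>{1..k}. (monom 1 (n i) - 1) div gcd (g i) (monom 1 (n i) - 1)) dvd poly_of_vec v"
proof -
  have "(\<forall>x\<in>set (cols (gen_circulant m (n i) (g i))). v \<bullet> x = 0) \<longleftrightarrow>
    (monom 1 (n i) - 1) div gcd (g i) (monom 1 (n i) - 1) dvd poly_of_vec v"
    if "i \<in> {1..k}" for i
    using assms that dvd_mult_iff_div_gcd_dvd[OF monom_minus_one(2), of "n i" "poly_of_vec v" "g i"]
    by (simp add: gen_circulant_left_kernel)
  then show ?thesis
    by (simp add: set_cols_multi_circulant Lcm_dvd_iff)
qed

theorem theorem5p3:
  fixes m k s r :: nat
    and n :: "nat \<Rightarrow> nat"
    and g :: "nat \<Rightarrow> 'a::field_gcd poly"
    and M :: "'a mat"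
  assumes m_pos: "m > 0" and k_pos: "k > 0"
    and n_pos: "\<forall>i\<in>{1..k}. n i > 0"
    and char: "CHAR('a) = 0 \<or> (\<forall>i\<in>{1..k}. coprime CHAR('a) (n i))"
    and deg: "\<forall>i\<in>{1..k}. degree (g i) < n i"
    and M: "M = multi_circulant m k n g"
    and s: "s = degree (LCM i\<in>{1..k}. (monom 1 (n i) - 1) div gcd (g i) (monom 1 (n i) - 1))"
    and r: "r = min m s"
  shows "vec_space.rank m M = r \<and>
    distinct (take r (rows M)) \<and>
    module.lin_indpt class_ring (module_vec TYPE('a) (\<Sum>i = 1..k. n i)) (set (take r (rows M)))"
proof -
  define h :: "'a poly"
    where "h = (LCM i\<in>{1..k}. (monom 1 (n i) - 1) div gcd (g i) (monom 1 (n i) - 1))"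
  have h: "degree h = s" by (simp add: s h_def)
  have h0: "h \<noteq> 0"
  proof -
    have "(monom 1 (n i) - 1 :: 'a poly) div gcd (g i) (monom 1 (n i) - 1) \<noteq> 0"
      if "i \<in> {1..k}" for i
      using monom_minus_one(2)[of "n i", where 'a = 'a] n_pos that by (simp add: dvd_div_eq_0_iff)
    then show ?thesis by (auto simp: h_def Lcm_0_iff)
  qed
  have Mcarr: "M \<in> carrier_mat m (\<Sum>i = 1..k. n i)"
    unfolding M by (rule multi_circulant_carrier)
  have rm: "r \<le> m" by (simp add: r)
  have ker: "(\<forall>x\<in>set (cols M). v \<bullet> x = 0) \<longleftrightarrow> h dvd poly_of_vec v" if "v \<in> carrier_vec m" for v
    unfolding M h_def by (rule multi_circulant_left_kernel[OF n_pos deg that])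
  interpret vec_space "TYPE('a)" m .

  have indep: "v = 0\<^sub>v m"
    if v: "v \<in> carrier_vec m" and supp: "\<And>i. r \<le> i \<Longrightarrow> i < m \<Longrightarrow> v $ i = 0"
      and orth: "\<And>x. x \<in> set (cols M) \<Longrightarrow> v \<bullet> x = 0" for v
  proof (cases "r = 0")
    case True
    with v supp show ?thesis by (intro eq_vecI) auto
  next
    case False
    have "h dvd poly_of_vec v" using ker[OF v] orth by blast
    moreover have "degree (poly_of_vec v) < r"
      using False v supp by (intro degree_poly_of_vec_less) auto
    then have "degree (poly_of_vec v) < degree h" by (simp add: h r)
    ultimately have "poly_of_vec v = 0" using dvd_imp_degree_le not_less by blast
    then have "v $ i = 0" if "i < m" for i
      using that v coeff_poly_of_vec[of v i] by simp
    with v show ?thesis by (intro eq_vecI) auto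
  qed

  \<comment> \<open>Row \<open>i\<close> of \<open>B\<close> expresses row \<open>i\<close> of \<open>M\<close> by the first \<open>r\<close> rows.\<close>
  define B where "B = mat m r (\<lambda>(i, j). coeff (monom 1 i mod h) j)"
  have B: "B \<in> carrier_mat m r" by (simp add: B_def)
  \<comment> \<open>The remainder fits into \<open>r\<close> coefficients: if \<open>r = s\<close> because its degree is less than \<open>s\<close>
    (it is zero for \<open>s = 0\<close>), and if \<open>r = m\<close> because then it is \<open>X ^ i\<close> itself.\<close>
  have rem_high: "coeff (monom 1 i mod h) j = 0" if i: "i < m" and j: "r \<le> j" for i j
  proof (cases "s \<le> j")
    case True
    with degree_mod_less[OF h0, of "monom 1 i"] h show ?thesis by (auto intro: coeff_eq_0)
  next
    case False
    with i j have "i < j" "degree (monom 1 i :: 'a poly) < degree h"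
      by (auto simp: r h degree_monom_eq)
    then show ?thesis by (simp add: mod_poly_less)
  qed
  have col: "x = B *\<^sub>v vec r (($) x)" if x: "x \<in> set (cols M)" for x
  proof (rule eq_vecI)
    have xm: "x \<in> carrier_vec m" using x cols_dim Mcarr by blast
    then show "dim_vec x = dim_vec (B *\<^sub>v vec r (($) x))" by (simp add: B_def)
    fix i assume "i < dim_vec (B *\<^sub>v vec r (($) x))"
    then have i: "i < m" by (simp add: B_def)
    \<comment> \<open>\<open>X ^ i - (X ^ i mod h)\<close> is a multiple of \<open>h\<close>, so its coefficients are a relation between
      the rows; it determines entry \<open>i\<close> of any column from the first \<open>r\<close> entries.\<close>
    let ?q = "monom 1 i mod h"
    let ?p = "monom 1 i - ?q"
    let ?v = "vec m (coeff ?p)"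
    have "poly_of_vec ?v = ?p"
      using i rm rem_high by (intro poly_of_vec_coeff) auto
    moreover have "h dvd ?p" by (simp add: dvd_minus_mod)
    ultimately have "?v \<bullet> x = 0" using ker[of ?v] x by simp
    moreover have "?v \<bullet> x = x $ i - (\<Sum>j<m. coeff ?q j * x $ j)"
    proof -
      have "?v \<bullet> x = (\<Sum>j<m. (if j = i then x $ j else 0) - coeff ?q j * x $ j)"
        using xm by (auto simp: scalar_prod_def lessThan_atLeast0 left_diff_distrib
            intro!: sum.cong)
      with i show ?thesis by (simp add: sum_subtractf)
    qed
    moreover have "(\<Sum>j<m. coeff ?q j * x $ j) = (\<Sum>j<r. coeff ?q j * x $ j)"
      using rm rem_high[OF i] by (intro sum.mono_neutral_right) auto
    moreover have "(B *\<^sub>v vec r (($) x)) $ i = (\<Sum>j<r. coeff ?q j * x $ j)"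
      using i by (auto simp: B_def scalar_prod_def lessThan_atLeast0)
    ultimately show "x $ i = (B *\<^sub>v vec r (($) x)) $ i" by simp
  qed
  have "rank M \<le> r"
    using col by (intro rank_le_if_cols_in_range[OF Mcarr B]) (metis vec_carrier)
  moreover have "r \<le> rank M"
    by (rule rank_ge_if_rows_independent[OF Mcarr rm indep])
  ultimately have "rank M = r" by simp
  then show ?thesis
    by (intro conjI first_rows_lin_indpt[OF Mcarr rm indep])
qed

end
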